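(* Let $C=e_1C_1\oplus e_2C_2\oplus e_3C_3$ be a cyclic code of length $n$ over $R$, where $\gcd(n,p)=1$, and suppose $C_i=\langle f_i(x)\rangle$ with $f_i(x)$ an idempotent of $\mathbb{F}_{p^k}[x]/(x^n-1)$ for $i=1,2,3$. Then there is exactly one idempotent $e\in C$ such that $C=\langle e\rangle$ in $R[x]/(x^n-1)$, and it is $e=e_1f_1(x)+e_2f_2(x)+e_3f_3(x)$.
   Context: Let $p$ be a prime, $k\ge1$ and $r>1$ integers with $\gcd(r,p)=1$, and $R_r=\mathbb{F}_{p^k}[v]/\langle v^{r+1}-v\rangle$. In $R_r$ put $e_1=\frac1r(v+v^2+\dots+v^r)$, $e_2=-\frac1r(v+\dots+v^{r-1})+\frac{r-1}{r}v^r$, $e_3=1-v^r$; these are nonzero orthogonal idempotents with sum $1$. $R$ denotes the subring $R=e_1\mathbb{F}_{p^k}\oplus e_2\mathbb{F}_{p^k}\oplus e_3\mathbb{F}_{p^k}$ of $R_r$. A cyclic code of length $n$ over a commutative ring $A$ is an $A$-submodule of $A^n$ stable under $(c_0,\dots,c_{n-1})\mapsto(c_{n-1},c_0,\dots,c_{n-2})$; identifying $(c_0,\dots,c_{n-1})$ with $\sum c_ix^i$, cyclic codes are the ideals of $A[x]/(x^n-1)$. For a linear code $C$ over $R$, the associated codes are $C_1=\{s : \exists\, t,u\in\mathbb{F}_{p^k}^n,\ e_1s+e_2t+e_3u\in C\}$, $C_2=\{t : \exists\, s,u\in\mathbb{F}_{p^k}^n,\ e_1s+e_2t+e_3u\in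 C\}$, $C_3=\{u : \exists\, s,t\in\mathbb{F}_{p^k}^n,\ e_1s+e_2t+e_3u\in C\}$, and $C=e_1C_1\oplus e_2C_2\oplus e_3C_3$; if $C$ is cyclic, so are the $C_i$. *)

theory Defs
  imports "HOL-Computational_Algebra.Primes" "HOL-Algebra.UnivPoly" "HOL-Algebra.QuotRing"
begin

section \<open>Cyclic codes over a commutative ring\<close>

text \<open>
  Words of length \<open>n\<close> are extensional functions on \<open>{..<n}\<close>.  The fields \<open>mult\<close> and \<open>one\<close>
  are only there because the record of modules extends the record of rings.
\<close>

definition vec_module ::
  "('a, 'm) ring_scheme \<Rightarrow> nat \<Rightarrow> ('a, nat \<Rightarrow> 'a) module"
  where "vec_module A n =
    \<lparr>carrier = {..<n} \<rightarrow>\<^sub>E carrier A,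
     mult = (\<lambda>c d. \<lambda>i\<in>{..<n}. c i \<otimes>\<^bsub>A\<^esub> d i),
     one = (\<lambda>i\<in>{..<n}. \<one>\<^bsub>A\<^esub>),
     zero = (\<lambda>i\<in>{..<n}. \<zero>\<^bsub>A\<^esub>),
     add = (\<lambda>c d. \<lambda>i\<in>{..<n}. c i \<oplus>\<^bsub>A\<^esub> d i),
     smult = (\<lambda>a c. \<lambda>i\<in>{..<n}. a \<otimes>\<^bsub>A\<^esub> c i)\<rparr>"

lemma vec_module_is_module:
  assumes "cring A"
  shows "module A (vec_module A n)"
proof -
  interpret cring A by fact
  let ?V = "vec_module A n"
  have mem: "c i \<in> carrier A" if "c \<in> carrier ?V" "i < n" for c i
    using that by (auto simp: vec_module_def PiE_iff)
  have ext: "c = d"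
    if "c \<in> carrier ?V" "d \<in> carrier ?V" "\<And>i. i < n \<Longrightarrow> c i = d i" for c d
    using that by (intro PiE_ext[of c "{..<n}" "\<lambda>_. carrier A" d]) (auto simp: vec_module_def)
  have addc: "c \<oplus>\<^bsub>?V\<^esub> d \<in> carrier ?V" if "c \<in> carrier ?V" "d \<in> carrier ?V" for c d
    using mem[OF that(1)] mem[OF that(2)] by (auto simp: vec_module_def)
  have zeroc: "\<zero>\<^bsub>?V\<^esub> \<in> carrier ?V"
    by (auto simp: vec_module_def)
  have smultc: "a \<odot>\<^bsub>?V\<^esub> c \<in> carrier ?V" if "a \<in> carrier A" "c \<in> carrier ?V" for a c
    using that(1) mem[OF that(2)] by (auto simp: vec_module_def)
  have add_nth: "(c \<oplus>\<^bsub>?V\<^esub> d) i = c i \<oplus>\<^bsub>A\<^esub> d i" if "i < n" for c d i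
    using that by (simp add: vec_module_def)
  have zero_nth: "\<zero>\<^bsub>?V\<^esub> i = \<zero>\<^bsub>A\<^esub>" if "i < n" for i
    using that by (simp add: vec_module_def)
  have smult_nth: "(a \<odot>\<^bsub>?V\<^esub> c) i = a \<otimes>\<^bsub>A\<^esub> c i" if "i < n" for a c i
    using that by (simp add: vec_module_def)
  note nth = add_nth zero_nth smult_nth
  show ?thesis
  proof (rule moduleI)
    show "abelian_group ?V"
    proof (rule abelian_groupI)
      fix c assume c: "c \<in> carrier ?V"
      show "\<exists>d\<in>carrier ?V. d \<oplus>\<^bsub>?V\<^esub> c = \<zero>\<^bsub>?V\<^esub>"
      proof (rule bexI[of _ "(\<ominus>\<^bsub>A\<^esub> \<one>\<^bsub>A\<^esub>) \<odot>\<^bsub>?V\<^esub> c"])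
        show "(\<ominus>\<^bsub>A\<^esub> \<one>\<^bsub>A\<^esub>) \<odot>\<^bsub>?V\<^esub> c \<oplus>\<^bsub>?V\<^esub> c = \<zero>\<^bsub>?V\<^esub>"
          by (rule ext) (auto simp: nth mem[OF c] c addc smultc zeroc l_minus l_neg)
      qed (simp add: smultc c)
    qed (auto intro!: ext addc zeroc simp: nth mem a_ac)
  qed (auto intro!: ext addc smultc is_cring simp: nth mem l_distr r_distr m_assoc)
qed

definition cyclic_shift :: "nat \<Rightarrow> (nat \<Rightarrow> 'a) \<Rightarrow> nat \<Rightarrow> 'a"
  where "cyclic_shift n c = (\<lambda>i\<in>{..<n}. if i = 0 then c (n - 1) else c (i - 1))"

definition linear_code :: "('a, 'm) ring_scheme \<Rightarrow> nat \<Rightarrow> (nat \<Rightarrow> 'a) set \<Rightarrow> bool"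
  where "linear_code A n C \<longleftrightarrow> submodule C A (vec_module A n)"

definition cyclic_code :: "('a, 'm) ring_scheme \<Rightarrow> nat \<Rightarrow> (nat \<Rightarrow> 'a) set \<Rightarrow> bool"
  where "cyclic_code A n C \<longleftrightarrow> linear_code A n C \<and> (\<forall>c\<in>C. cyclic_shift n c \<in> C)"

text \<open>The ring \<open>A[x]/(x\<^sup>n - 1)\<close>, and the residue class in it of a polynomial.\<close>

definition cyc_modulus :: "('a, 'm) ring_scheme \<Rightarrow> nat \<Rightarrow> (nat \<Rightarrow> 'a) set"
  where "cyc_modulus A n =
    PIdl\<^bsub>UP A\<^esub> (monom (UP A) \<one>\<^bsub>A\<^esub> n \<ominus>\<^bsub>UP A\<^esub> \<one>\<^bsub>UP A\<^esub>)"

definition cyc_ring :: "('a, 'm) ring_scheme \<Rightarrow> nat \<Rightarrow> (nat \<Rightarrow> 'a) set ring"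
  where "cyc_ring A n = UP A Quot cyc_modulus A n"

definition cyc_class ::
  "('a, 'm) ring_scheme \<Rightarrow> nat \<Rightarrow> (nat \<Rightarrow> 'a) \<Rightarrow> (nat \<Rightarrow> 'a) set"
  where "cyc_class A n f = cyc_modulus A n +>\<^bsub>UP A\<^esub> f"

text \<open>The identification of words with residue classes, and the image of a code under it.\<close>

definition word_class ::
  "('a, 'm) ring_scheme \<Rightarrow> nat \<Rightarrow> (nat \<Rightarrow> 'a) \<Rightarrow> (nat \<Rightarrow> 'a) set"
  where "word_class A n c =
    cyc_class A n (\<Oplus>\<^bsub>UP A\<^esub>i\<in>{..<n}. monom (UP A) (c i) i)"

definition code_ideal ::
  "('a, 'm) ring_scheme \<Rightarrow> nat \<Rightarrow> (nat \<Rightarrow> 'a) set \<Rightarrow> (nat \<Rightarrow> 'a) set set"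
  where "code_ideal A n C = word_class A n ` C"

definition idempotent_elem :: "('a, 'm) ring_scheme \<Rightarrow> 'a \<Rightarrow> bool"
  where "idempotent_elem A a \<longleftrightarrow> a \<in> carrier A \<and> a \<otimes>\<^bsub>A\<^esub> a = a"


section \<open>The ring \<open>F[v]/(v\<^sup>r\<^sup>+\<^sup>1 - v)\<close> and its subring\<close>

definition v_modulus :: "('a, 'm) ring_scheme \<Rightarrow> nat \<Rightarrow> (nat \<Rightarrow> 'a) set"
  where "v_modulus F r =
    PIdl\<^bsub>UP F\<^esub> (monom (UP F) \<one>\<^bsub>F\<^esub> (r + 1) \<ominus>\<^bsub>UP F\<^esub> monom (UP F) \<one>\<^bsub>F\<^esub> 1)"

definition v_ring :: "('a, 'm) ring_scheme \<Rightarrow> nat \<Rightarrow> (nat \<Rightarrow> 'a) set ring"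
  where "v_ring F r = UP F Quot v_modulus F r"

definition v_elem :: "('a, 'm) ring_scheme \<Rightarrow> nat \<Rightarrow> (nat \<Rightarrow> 'a) set"
  where "v_elem F r = v_modulus F r +>\<^bsub>UP F\<^esub> monom (UP F) \<one>\<^bsub>F\<^esub> 1"

text \<open>The structure map from \<open>F\<close>, which makes the inclusion of scalars explicit.\<close>

definition v_const :: "('a, 'm) ring_scheme \<Rightarrow> nat \<Rightarrow> 'a \<Rightarrow> (nat \<Rightarrow> 'a) set"
  where "v_const F r a = v_modulus F r +>\<^bsub>UP F\<^esub> monom (UP F) a 0"

definition idem_e1 :: "('a, 'm) ring_scheme \<Rightarrow> nat \<Rightarrow> (nat \<Rightarrow> 'a) set"
  where "idem_e1 F r =
    v_const F r (inv\<^bsub>F\<^esub> ([r] \<cdot>\<^bsub>F\<^esub> \<one>\<^bsub>F\<^esub>))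
      \<otimes>\<^bsub>v_ring F r\<^esub> (\<Oplus>\<^bsub>v_ring F r\<^esub>i\<in>{1..r}. v_elem F r [^]\<^bsub>v_ring F r\<^esub> i)"

definition idem_e2 :: "('a, 'm) ring_scheme \<Rightarrow> nat \<Rightarrow> (nat \<Rightarrow> 'a) set"
  where "idem_e2 F r =
    \<ominus>\<^bsub>v_ring F r\<^esub> (v_const F r (inv\<^bsub>F\<^esub> ([r] \<cdot>\<^bsub>F\<^esub> \<one>\<^bsub>F\<^esub>))
      \<otimes>\<^bsub>v_ring F r\<^esub> (\<Oplus>\<^bsub>v_ring F r\<^esub>i\<in>{1..r - 1}. v_elem F r [^]\<^bsub>v_ring F r\<^esub> i))
    \<oplus>\<^bsub>v_ring F r\<^esub>
      v_const F r (([(r - 1)] \<cdot>\<^bsub>F\<^esub> \<one>\<^bsub>F\<^esub>) \<otimes>\<^bsub>F\<^esub> inv\<^bsub>F\<^esub> ([r] \<cdot>\<^bsub>F\<^esub> \<one>\<^bsub>F\<^esub>))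
      \<otimes>\<^bsub>v_ring F r\<^esub> v_elem F r [^]\<^bsub>v_ring F r\<^esub> r"

definition idem_e3 :: "('a, 'm) ring_scheme \<Rightarrow> nat \<Rightarrow> (nat \<Rightarrow> 'a) set"
  where "idem_e3 F r = \<one>\<^bsub>v_ring F r\<^esub> \<ominus>\<^bsub>v_ring F r\<^esub> v_elem F r [^]\<^bsub>v_ring F r\<^esub> r"

definition e_comb ::
  "('a, 'm) ring_scheme \<Rightarrow> nat \<Rightarrow> 'a \<Rightarrow> 'a \<Rightarrow> 'a \<Rightarrow> (nat \<Rightarrow> 'a) set"
  where "e_comb F r a b c =
    idem_e1 F r \<otimes>\<^bsub>v_ring F r\<^esub> v_const F r a
    \<oplus>\<^bsub>v_ring F r\<^esub> idem_e2 F r \<otimes>\<^bsub>v_ring F r\<^esub> v_const F r b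
    \<oplus>\<^bsub>v_ring F r\<^esub> idem_e3 F r \<otimes>\<^bsub>v_ring F r\<^esub> v_const F r c"

definition e_ring :: "('a, 'm) ring_scheme \<Rightarrow> nat \<Rightarrow> (nat \<Rightarrow> 'a) set ring"
  where "e_ring F r = (v_ring F r)
    \<lparr>carrier := {e_comb F r a b c | a b c. a \<in> carrier F \<and> b \<in> carrier F \<and> c \<in> carrier F}\<rparr>"


section \<open>Components of a code over the subring\<close>

definition word_comb ::
  "('a, 'm) ring_scheme \<Rightarrow> nat \<Rightarrow> nat \<Rightarrow> (nat \<Rightarrow> 'a) \<Rightarrow> (nat \<Rightarrow> 'a) \<Rightarrow> (nat \<Rightarrow> 'a)
    \<Rightarrow> nat \<Rightarrow> (nat \<Rightarrow> 'a) set"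
  where "word_comb F r n s t u = (\<lambda>i\<in>{..<n}. e_comb F r (s i) (t i) (u i))"

definition component1 ::
  "('a, 'm) ring_scheme \<Rightarrow> nat \<Rightarrow> nat \<Rightarrow> (nat \<Rightarrow> (nat \<Rightarrow> 'a) set) set \<Rightarrow> (nat \<Rightarrow> 'a) set"
  where "component1 F r n C = {s \<in> carrier (vec_module F n).
    \<exists>t\<in>carrier (vec_module F n). \<exists>u\<in>carrier (vec_module F n). word_comb F r n s t u \<in> C}"

definition component2 ::
  "('a, 'm) ring_scheme \<Rightarrow> nat \<Rightarrow> nat \<Rightarrow> (nat \<Rightarrow> (nat \<Rightarrow> 'a) set) set \<Rightarrow> (nat \<Rightarrow> 'a) set"
  where "component2 F r n C = {t \<in> carrier (vec_module F n).
    \<exists>s\<in>carrier (vec_module F n). \<exists>u\<in>carrier (vec_module F n). word_comb F r n s t u \<in> C}"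

definition component3 ::
  "('a, 'm) ring_scheme \<Rightarrow> nat \<Rightarrow> nat \<Rightarrow> (nat \<Rightarrow> (nat \<Rightarrow> 'a) set) set \<Rightarrow> (nat \<Rightarrow> 'a) set"
  where "component3 F r n C = {u \<in> carrier (vec_module F n).
    \<exists>s\<in>carrier (vec_module F n). \<exists>t\<in>carrier (vec_module F n). word_comb F r n s t u \<in> C}"

text \<open>
  The polynomial \<open>e\<^sub>1 f\<^sub>1 + e\<^sub>2 f\<^sub>2 + e\<^sub>3 f\<^sub>3\<close> over \<open>e_ring F r\<close>, where each \<open>f\<^sub>i\<close> has its coefficients
  in \<open>F\<close>; these are mapped through the structure map.
\<close>

definition poly_comb ::
  "('a, 'm) ring_scheme \<Rightarrow> nat \<Rightarrow> (nat \<Rightarrow> 'a) \<Rightarrow> (nat \<Rightarrow> 'a) \<Rightarrow> (nat \<Rightarrow> 'a)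
    \<Rightarrow> nat \<Rightarrow> (nat \<Rightarrow> 'a) set"
  where "poly_comb F r f g h =
    idem_e1 F r \<odot>\<^bsub>UP (e_ring F r)\<^esub> (v_const F r \<circ> f)
    \<oplus>\<^bsub>UP (e_ring F r)\<^esub> idem_e2 F r \<odot>\<^bsub>UP (e_ring F r)\<^esub> (v_const F r \<circ> g)
    \<oplus>\<^bsub>UP (e_ring F r)\<^esub> idem_e3 F r \<odot>\<^bsub>UP (e_ring F r)\<^esub> (v_const F r \<circ> h)"

end

theory Submission
  imports Defs "HOL-Algebra.Subrings"
begin

text \<open>
  With \<open>w = v\<^sup>r\<close> and \<open>s = v + \<dots> + v\<^sup>r\<close>, the relation \<open>v\<^sup>r\<^sup>+\<^sup>1 = v\<close> gives \<open>vs = s\<close>, \<open>s\<^sup>2 = rs\<close> and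
  \<open>w\<^sup>2 = w\<close>, so \<open>e\<^sub>1 = s/r\<close>, \<open>e\<^sub>2 = w - e\<^sub>1\<close> and \<open>e\<^sub>3 = 1 - w\<close> are orthogonal idempotents of sum
  \<open>1\<close>.  The operations on \<open>e\<^sub>1 f + e\<^sub>2 g + e\<^sub>3 h\<close> are therefore componentwise, for scalars, for
  polynomials and for residue classes.  A code over \<open>R\<close> corresponds to the triples of elements of
  its component codes, hence to the triples of multiples of \<open>f\<^sub>1, f\<^sub>2, f\<^sub>3\<close>, which are the multiples
  of \<open>e\<^sub>1 f\<^sub>1 + e\<^sub>2 f\<^sub>2 + e\<^sub>3 f\<^sub>3\<close>.  Two idempotents generating the same principal ideal of a
  commutative ring absorb each other, so they are equal.
\<close>

section \<open>Three orthogonal idempotents of sum one in a commutative ring\<close>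

locale orth_idempotents = cring +
  fixes e1 e2 e3
  assumes closed [simp]: "e1 \<in> carrier R" "e2 \<in> carrier R" "e3 \<in> carrier R"
    and idem: "e1 \<otimes> e1 = e1" "e2 \<otimes> e2 = e2" "e3 \<otimes> e3 = e3"
    and orth: "e1 \<otimes> e2 = \<zero>" "e1 \<otimes> e3 = \<zero>" "e2 \<otimes> e3 = \<zero>"
    and total: "e1 \<oplus> e2 \<oplus> e3 = \<one>"
begin

definition comb where "comb x y z = e1 \<otimes> x \<oplus> e2 \<otimes> y \<oplus> e3 \<otimes> z"

lemma comb_closed [simp]:
  "\<lbrakk>x \<in> carrier R; y \<in> carrier R; z \<in> carrier R\<rbrakk> \<Longrightarrow> comb x y z \<in> carrier R"
  by (simp add: comb_def)

text \<open>Since the idempotents sum to \<open>1\<close>, an element of the ring has itself as each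
  of three coordinates. This places \<open>0\<close>, \<open>1\<close> and embedded scalars among
  the combinations.\<close>

lemma comb_diag: "x \<in> carrier R \<Longrightarrow> comb x x x = x"
  by (simp add: comb_def total flip: l_distr)

lemma comb_add:
  assumes "x \<in> carrier R" "y \<in> carrier R" "z \<in> carrier R"
    "x' \<in> carrier R" "y' \<in> carrier R" "z' \<in> carrier R"
  shows "comb x y z \<oplus> comb x' y' z' = comb (x \<oplus> x') (y \<oplus> y') (z \<oplus> z')"
  using assms by (simp add: comb_def r_distr a_ac)

lemma comb_mult:
  assumes "x \<in> carrier R" "y \<in> carrier R" "z \<in> carrier R"
    "x' \<in> carrier R" "y' \<in> carrier R" "z' \<in> carrier R"
  shows "comb x y z \<otimes> comb x' y' z' = comb (x \<otimes> x') (y \<otimes> y') (z \<otimes> z')"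
proof -
  have swap: "(a \<otimes> p) \<otimes> (b \<otimes> q) = (a \<otimes> b) \<otimes> (p \<otimes> q)"
    if "a \<in> carrier R" "b \<in> carrier R" "p \<in> carrier R" "q \<in> carrier R" for a b p q
    using that by (simp add: m_ac)
  have orth': "e2 \<otimes> e1 = \<zero>" "e3 \<otimes> e1 = \<zero>" "e3 \<otimes> e2 = \<zero>"
    using orth by (simp_all add: m_comm)
  show ?thesis
    using assms by (simp add: comb_def l_distr r_distr swap idem orth orth')
qed

end

text \<open>Everything follows from \<open>v^(r+1) = v\<close> and an inverse \<open>c\<close> of
  \<open>r\<close>, so the computation takes place in an arbitrary commutative ring. The second
  idempotent appears as \<open>v^r - c s\<close>, which is easier to multiply than its explicit
  expansion; \<open>idem_e2_eq\<close> reconciles the two forms.\<close>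

lemma (in cring) orth_idempotents_of_pow_Suc_eq:
  assumes v: "v \<in> carrier R" "v [^] Suc r = v" and "r > 0"
    and c: "c \<in> carrier R" "c \<otimes> ([r] \<cdot> \<one>) = \<one>"
    and s: "s = (\<Oplus>i\<in>{1..r}. v [^] i)"
  shows "orth_idempotents R (c \<otimes> s) (v [^] r \<ominus> c \<otimes> s) (\<one> \<ominus> v [^] r)"
proof -
  define w where "w = v [^] r"
  have sC [simp]: "s \<in> carrier R" and w [simp]: "w \<in> carrier R"
    using v by (auto simp: s w_def)
  note [simp] = v(1) c(1)
  \<comment> \<open>Multiplying the sum by \<open>v\<close> shifts the exponents: \<open>v\<close>
    is lost and \<open>v^(m+1)\<close> is gained. With \<open>v\<close> added on the left no
    subtraction occurs. At \<open>m = r\<close> the gained power is \<open>v\<close> again and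
    cancels, so \<open>v s = s\<close>.\<close>
  have "v \<otimes> (\<Oplus>i\<in>{1..m}. v [^] i) \<oplus> v = (\<Oplus>i\<in>{1..m}. v [^] i) \<oplus> v [^] Suc m" for m
  proof (induction m)
    case (Suc m)
    let ?t = "\<Oplus>i\<in>{1..m}. v [^] i"
    have t: "?t \<in> carrier R" by auto
    have ins: "(\<Oplus>i\<in>{1..Suc m}. v [^] i) = v [^] Suc m \<oplus> ?t"
      by (simp add: atLeastAtMostSuc_conv del: nat_pow_Suc)
    have "v \<otimes> (v [^] Suc m \<oplus> ?t) \<oplus> v = v \<otimes> v [^] Suc m \<oplus> (v \<otimes> ?t \<oplus> v)"
      using t by (simp add: r_distr a_assoc)
    also have "\<dots> = v \<otimes> v [^] Suc m \<oplus> (?t \<oplus> v [^] Suc m)"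
      by (simp only: Suc.IH)
    also have "\<dots> = (v [^] Suc m \<oplus> ?t) \<oplus> v [^] Suc (Suc m)"
      using t by (simp add: a_ac m_ac)
    finally show ?case by (simp only: ins)
  qed simp
  from this[of r] have "v \<otimes> s \<oplus> v = s \<oplus> v"
    using v(2) by (simp add: s)
  then have vs: "v \<otimes> s = s" by simp
  have pow_s: "v [^] i \<otimes> s = s" for i :: nat
    by (induction i) (simp_all add: m_assoc vs)
  have "s \<otimes> s = (\<Oplus>i\<in>{1..r}. v [^] i \<otimes> s)"
    by (subst (1) s) (simp add: finsum_ldistr)
  also have "\<dots> = (\<Oplus>i\<in>{1..r}. s)"
    by (simp add: pow_s)
  also have "\<dots> = [r] \<cdot> s"
    by (simp add: add.finprod_const)
  also have "\<dots> = ([r] \<cdot> \<one>) \<otimes> s"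
    by (simp add: add_pow_ldistr)
  finally have ss: "s \<otimes> s = ([r] \<cdot> \<one>) \<otimes> s" .
  define a where "a = c \<otimes> s"
  have a [simp]: "a \<in> carrier R" by (simp add: a_def)
  have "a \<otimes> a = c \<otimes> (c \<otimes> (s \<otimes> s))"
    by (simp add: a_def m_ac)
  \<comment> \<open>The factor \<open>r\<close> coming from \<open>s s = r s\<close> is grouped with
    one \<open>c\<close>, where the two cancel.\<close>
  also have "\<dots> = c \<otimes> ((c \<otimes> ([r] \<cdot> \<one>)) \<otimes> s)"
    by (simp only: ss) (simp add: m_assoc)
  finally have aa: "a \<otimes> a = a"
    by (simp add: c(2)) (simp add: a_def)
  have wa: "w \<otimes> a = a"
    using pow_s[of r] by (simp add: a_def w_def m_lcomm)
  \<comment> \<open>Positivity of \<open>r\<close> allows the split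
    \<open>2r = (r + 1) + (r - 1)\<close>. Hence
    \<open>w w = v^(r+1) v^(r-1) = v v^(r-1) = w\<close>.\<close>
  obtain q where q: "r = Suc q" using \<open>r > 0\<close> by (cases r) auto
  have "w \<otimes> w = v [^] (Suc r + q)"
    unfolding w_def q by (simp only: nat_pow_mult v(1)) simp
  also have "\<dots> = v \<otimes> v [^] q"
    using nat_pow_mult[of v "Suc r" q] v by simp
  also have "\<dots> = w"
    by (simp add: w_def q m_comm)
  finally have ww: "w \<otimes> w = w" .
  have aw: "a \<otimes> w = a" using wa by (simp add: m_comm)
  have "orth_idempotents R a (w \<ominus> a) (\<one> \<ominus> w)"
  proof unfold_locales
    show "(w \<ominus> a) \<otimes> (w \<ominus> a) = w \<ominus> a" 
      by (simp add: minus_eq l_distr r_distr l_minus r_minus aa wa aw ww a_ac r_neg r_neg2)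
    show "(\<one> \<ominus> w) \<otimes> (\<one> \<ominus> w) = \<one> \<ominus> w"
      by (simp add: minus_eq l_distr r_distr l_minus r_minus ww a_ac r_neg)
    show "a \<otimes> (w \<ominus> a) = \<zero>" "a \<otimes> (\<one> \<ominus> w) = \<zero>" "(w \<ominus> a) \<otimes> (\<one> \<ominus> w) = \<zero>" 
      by (simp_all add: minus_eq l_distr r_distr l_minus r_minus aa wa aw ww a_ac r_neg r_neg2)
    show "a \<oplus> (w \<ominus> a) \<oplus> (\<one> \<ominus> w) = \<one>"
      using a w by algebra
  qed (simp_all add: aa)
  then show ?thesis by (simp add: a_def w_def)
qed

text \<open>An element of the ideal of an idempotent \<open>y\<close> is some \<open>z y\<close>,
  and \<open>z y y = z y\<close>; so \<open>y\<close> is an identity element on its ideal. Two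
  identity elements of the same ideal coincide.\<close>

lemma (in cring) cgenideal_idem_unique:
  assumes "a \<in> carrier R" "b \<in> carrier R" "a \<otimes> a = a" "b \<otimes> b = b" "PIdl a = PIdl b"
  shows "a = b"
proof -
  have absorb: "x = x \<otimes> y"
    if xy: "x \<in> carrier R" "y \<in> carrier R" "y \<otimes> y = y" "PIdl x = PIdl y" for x y
  proof -
    obtain z where "z \<in> carrier R" "x = z \<otimes> y"
      using cgenideal_self[OF xy(1)] xy(4) by (auto simp: cgenideal_def)
    then show ?thesis using xy by (simp add: m_assoc)
  qed
  have "a = a \<otimes> b" using assms by (intro absorb)
  moreover have "b = b \<otimes> a" using assms by (intro absorb) auto
  ultimately show ?thesis using assms by (metis m_comm)
qed

section \<open>Coefficient homomorphisms on polynomials and on residue classes\<close>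

context ring_hom_cring
begin

lemma up_compose: "f \<in> up R \<Longrightarrow> h \<circ> f \<in> up S"
proof -
  assume f: "f \<in> up R"
  then obtain n where "bound \<zero> n f" by auto
  then have "bound \<zero>\<^bsub>S\<^esub> n (h \<circ> f)"
    by (auto simp: bound_def)
  then show ?thesis using f by (intro mem_upI) auto
qed

lemma UP_compose_hom: "ring_hom_cring (UP R) (UP S) (\<lambda>f. h \<circ> f)"
proof -
  interpret P: UP_cring R "UP R" by unfold_locales
  interpret Q: UP_cring S "UP S" by unfold_locales
  have "(\<lambda>f. h \<circ> f) \<in> ring_hom (UP R) (UP S)"
  proof (rule ring_hom_memI)
    fix f g assume f: "f \<in> carrier (UP R)" and g: "g \<in> carrier (UP R)"
    then have up: "f \<in> up R" "g \<in> up R" by (simp_all add: UP_def)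
    show "h \<circ> f \<otimes>\<^bsub>UP R\<^esub> g = (h \<circ> f) \<otimes>\<^bsub>UP S\<^esub> (h \<circ> g)"
    proof
      fix k
      \<comment> \<open>This membership is the side condition for moving \<open>h\<close> inside the
        convolution sum.\<close>
      have "(\<lambda>i. f i \<otimes> g (k - i)) \<in> {..k} \<rightarrow> carrier R"
        using up by auto
      then show "(h \<circ> f \<otimes>\<^bsub>UP R\<^esub> g) k = ((h \<circ> f) \<otimes>\<^bsub>UP S\<^esub> (h \<circ> g)) k"
        using up by (auto simp: UP_def up_compose[unfolded comp_def] comp_def mem_upD intro!: S.finsum_cong')
    qed
    show "h \<circ> f \<oplus>\<^bsub>UP R\<^esub> g = (h \<circ> f) \<oplus>\<^bsub>UP S\<^esub> (h \<circ> g)"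
      using up by (auto simp: UP_def up_compose[unfolded comp_def] comp_def mem_upD)
  qed (auto simp: UP_def up_compose)
  then show ?thesis by unfold_locales
qed

lemma compose_monom:
  "a \<in> carrier R \<Longrightarrow> h \<circ> monom (UP R) a n = monom (UP S) (h a) n"
  by (auto simp: UP_def)

end

lemma (in cring) cyc_modulus_ideal: "ideal (cyc_modulus R n) (UP R)"
proof -
  interpret P: UP_cring R "UP R" by unfold_locales
  show ?thesis unfolding cyc_modulus_def by (intro P.cgenideal_ideal) simp
qed

text \<open>Arithmetic with residue classes is thereby carried out on polynomial
  representatives.\<close>

lemma (in cring) cyc_class_hom: "ring_hom_cring (UP R) (cyc_ring R n) (cyc_class R n)"
proof -
  interpret P: UP_cring R "UP R" by unfold_locales
  interpret I: ideal "cyc_modulus R n" "UP R" by (rule cyc_modulus_ideal)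
  have "cyc_class R n = (+>\<^bsub>UP R\<^esub>) (cyc_modulus R n)"
    by (rule ext) (simp add: cyc_class_def)
  then show ?thesis
    using I.rcos_ring_hom_cring[OF P.P.is_cring] by (simp add: cyc_ring_def)
qed

lemma (in cring) carrier_cyc_ring: "carrier (cyc_ring R n) = cyc_class R n ` carrier (UP R)"
  by (auto simp: cyc_ring_def cyc_class_def FactRing_def A_RCOSETS_def' a_r_coset_def)

lemma (in cring) cyc_class_eq_iff:
  assumes "f \<in> carrier (UP R)" "g \<in> carrier (UP R)"
  shows "cyc_class R n f = cyc_class R n g \<longleftrightarrow> f \<ominus>\<^bsub>UP R\<^esub> g \<in> cyc_modulus R n"
proof -
  interpret P: UP_cring R "UP R" by unfold_locales
  interpret I: ideal "cyc_modulus R n" "UP R" by (rule cyc_modulus_ideal)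
  show ?thesis
    using assms P.P.quotient_eq_iff_same_a_r_cos[OF I.is_ideal, of f g] by (simp add: cyc_class_def)
qed

text \<open>A unital homomorphism sends \<open>x^n - 1\<close> to \<open>x^n - 1\<close>, so a
  multiple of the modulus goes to a multiple of the modulus. This is the induced map of the
  quotients, expressed on representatives.\<close>

lemma (in ring_hom_cring) cyc_class_compose_cong:
  assumes "f \<in> carrier (UP R)" "g \<in> carrier (UP R)" "cyc_class R n f = cyc_class R n g"
  shows "cyc_class S n (h \<circ> f) = cyc_class S n (h \<circ> g)"
proof -
  interpret P: UP_cring R "UP R" by unfold_locales
  interpret Q: UP_cring S "UP S" by unfold_locales
  interpret H: ring_hom_cring "UP R" "UP S" "\<lambda>f. h \<circ> f" by (rule UP_compose_hom)
  obtain q where q: "q \<in> carrier (UP R)"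
    "f \<ominus>\<^bsub>UP R\<^esub> g = q \<otimes>\<^bsub>UP R\<^esub> (monom (UP R) \<one> n \<ominus>\<^bsub>UP R\<^esub> \<one>\<^bsub>UP R\<^esub>)"
    using assms R.cyc_class_eq_iff by (auto simp: cyc_modulus_def cgenideal_def)
  have "(h \<circ> f) \<ominus>\<^bsub>UP S\<^esub> (h \<circ> g) = h \<circ> (f \<ominus>\<^bsub>UP R\<^esub> g)"
    using assms by (simp add: P.P.minus_eq Q.P.minus_eq)
  also have "\<dots> = (h \<circ> q) \<otimes>\<^bsub>UP S\<^esub> (monom (UP S) \<one>\<^bsub>S\<^esub> n \<ominus>\<^bsub>UP S\<^esub> \<one>\<^bsub>UP S\<^esub>)"
    unfolding q(2) using q(1) by (simp add: P.P.minus_eq Q.P.minus_eq compose_monom)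
  finally have "(h \<circ> f) \<ominus>\<^bsub>UP S\<^esub> (h \<circ> g) \<in> cyc_modulus S n"
    unfolding cyc_modulus_def cgenideal_def using H.hom_closed[OF q(1)] by blast
  then show ?thesis
    using S.cyc_class_eq_iff H.hom_closed assms(1,2) by blast
qed

section \<open>Extensions of a ring spanned by three orthogonal idempotents\<close>

locale idempotent_extension =
  \<phi>: ring_hom_cring F R \<phi> + orth_idempotents R e1 e2 e3
  for F (structure) and R (structure) and \<phi> e1 e2 e3 +
  assumes span: "x \<in> carrier R \<Longrightarrow>
    \<exists>a\<in>carrier F. \<exists>b\<in>carrier F. \<exists>c\<in>carrier F. x = comb (\<phi> a) (\<phi> b) (\<phi> c)"
begin

sublocale F: UP_cring F "UP F" by unfold_locales
sublocale U: UP_cring R "UP R" by unfold_locales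
sublocale \<Phi>: ring_hom_cring "UP F" "UP R" "\<lambda>f. \<phi> \<circ> f" by (rule \<phi>.UP_compose_hom)

text \<open>As constant polynomials the idempotents keep their relations, so the componentwise rules
  hold for polynomials too.\<close>

sublocale E: orth_idempotents "UP R" "monom (UP R) e1 0" "monom (UP R) e2 0" "monom (UP R) e3 0"
proof unfold_locales
  show "monom (UP R) e1 0 \<oplus>\<^bsub>UP R\<^esub> monom (UP R) e2 0 \<oplus>\<^bsub>UP R\<^esub> monom (UP R) e3 0 = \<one>\<^bsub>UP R\<^esub>"
    by (simp add: total flip: U.monom_add)
qed (simp_all add: idem orth flip: U.monom_mult)

text \<open>The polynomial \<open>e1 f + e2 g + e3 h\<close> with coefficients carried along
  \<open>\<phi>\<close>. The idempotents enter as constant factors, so that the rules for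
  \<open>E.comb\<close> apply; \<open>pcomb_smult\<close> passes to scalar multiplication.\<close>

definition pcomb where "pcomb f g h = E.comb (\<phi> \<circ> f) (\<phi> \<circ> g) (\<phi> \<circ> h)"

lemma pcomb_closed [simp]:
  "\<lbrakk>f \<in> carrier (UP F); g \<in> carrier (UP F); h \<in> carrier (UP F)\<rbrakk>
    \<Longrightarrow> pcomb f g h \<in> carrier (UP R)"
  by (simp add: pcomb_def)

lemma pcomb_smult:
  assumes "f \<in> carrier (UP F)" "g \<in> carrier (UP F)" "h \<in> carrier (UP F)"
  shows "pcomb f g h = e1 \<odot>\<^bsub>UP R\<^esub> (\<phi> \<circ> f) \<oplus>\<^bsub>UP R\<^esub> e2 \<odot>\<^bsub>UP R\<^esub> (\<phi> \<circ> g) \<oplus>\<^bsub>UP R\<^esub> e3 \<odot>\<^bsub>UP R\<^esub> (\<phi> \<circ> h)"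
  using assms by (simp add: pcomb_def E.comb_def U.monom_mult_is_smult)

lemma pcomb_nth:
  assumes "f \<in> carrier (UP F)" "g \<in> carrier (UP F)" "h \<in> carrier (UP F)"
  shows "pcomb f g h i = comb (\<phi> (f i)) (\<phi> (g i)) (\<phi> (h i))"
proof -
  \<comment> \<open>A polynomial is its own coefficient function, which brings the rules for
    \<open>coeff\<close> to bear on plain application.\<close>
  have coeff: "coeff (UP R) p = p" if "p \<in> carrier (UP R)" for p
    using that by (simp add: UP_def)
  have "pcomb f g h i = coeff (UP R) (pcomb f g h) i"
    using assms by (simp add: coeff)
  also have "\<dots> = comb (coeff (UP R) (\<phi> \<circ> f) i) (coeff (UP R) (\<phi> \<circ> g) i) (coeff (UP R) (\<phi> \<circ> h) i)"
    unfolding pcomb_smult[OF assms] comb_def using assms by (simp del: comp_apply)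
  finally show ?thesis
    using assms by (simp add: coeff)
qed

lemma pcomb_mult:
  assumes "f \<in> carrier (UP F)" "g \<in> carrier (UP F)" "h \<in> carrier (UP F)"
    "f' \<in> carrier (UP F)" "g' \<in> carrier (UP F)" "h' \<in> carrier (UP F)"
  shows "pcomb f g h \<otimes>\<^bsub>UP R\<^esub> pcomb f' g' h' =
    pcomb (f \<otimes>\<^bsub>UP F\<^esub> f') (g \<otimes>\<^bsub>UP F\<^esub> g') (h \<otimes>\<^bsub>UP F\<^esub> h')"
  using assms by (simp add: pcomb_def E.comb_mult)

lemma pcomb_surj:
  assumes "q \<in> carrier (UP R)"
  obtains f g h where "f \<in> carrier (UP F)" "g \<in> carrier (UP F)" "h \<in> carrier (UP F)"
    "q = pcomb f g h"
proof -
  have q: "q \<in> up R" using assms by (simp add: UP_def)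
  \<comment> \<open>The coefficients are chosen to be zero wherever \<open>q\<close> vanishes, so that the supports are finite.\<close>
  have "\<exists>a b c. (a \<in> carrier F \<and> b \<in> carrier F \<and> c \<in> carrier F) \<and> q i = comb (\<phi> a) (\<phi> b) (\<phi> c)
      \<and> (q i = \<zero>\<^bsub>R\<^esub> \<longrightarrow> a = \<zero>\<^bsub>F\<^esub> \<and> b = \<zero>\<^bsub>F\<^esub> \<and> c = \<zero>\<^bsub>F\<^esub>)" for i
  proof (cases "q i = \<zero>\<^bsub>R\<^esub>")
    case True
    then show ?thesis by (intro exI[of _ "\<zero>\<^bsub>F\<^esub>"]) (simp add: comb_diag)
  next
    case False
    then show ?thesis using span[of "q i"] mem_upD[OF q] by metis
  qed
  then obtain f g h where fgh: "\<And>i. f i \<in> carrier F \<and> g i \<in> carrier F \<and> h i \<in> carrier F"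
    "\<And>i. q i = comb (\<phi> (f i)) (\<phi> (g i)) (\<phi> (h i))"
    "\<And>i. q i = \<zero>\<^bsub>R\<^esub> \<Longrightarrow> f i = \<zero>\<^bsub>F\<^esub> \<and> g i = \<zero>\<^bsub>F\<^esub> \<and> h i = \<zero>\<^bsub>F\<^esub>"
    by metis
  obtain N where "bound \<zero>\<^bsub>R\<^esub> N q" using q by auto
  then have N: "bound \<zero>\<^bsub>F\<^esub> N f" "bound \<zero>\<^bsub>F\<^esub> N g" "bound \<zero>\<^bsub>F\<^esub> N h"
    using fgh(3) by (auto simp: bound_def)
  have up: "f \<in> carrier (UP F)" "g \<in> carrier (UP F)" "h \<in> carrier (UP F)"
    using fgh(1) N by (auto simp: UP_def)
  show ?thesis
    using up fgh(2) by (intro that[OF up] ext) (simp add: pcomb_nth)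
qed

text \<open>Each summand is a constant times an image under \<open>\<phi>\<close>, and its class
  depends only on the class of the polynomial over \<open>F\<close>. Hence the three representatives
  may be exchanged freely.\<close>

lemma cyc_class_pcomb_cong:
  assumes "f \<in> carrier (UP F)" "g \<in> carrier (UP F)" "h \<in> carrier (UP F)"
    "f' \<in> carrier (UP F)" "g' \<in> carrier (UP F)" "h' \<in> carrier (UP F)"
    and "cyc_class F n f = cyc_class F n f'" "cyc_class F n g = cyc_class F n g'"
      "cyc_class F n h = cyc_class F n h'"
  shows "cyc_class R n (pcomb f g h) = cyc_class R n (pcomb f' g' h')"
proof -
  interpret K: ring_hom_cring "UP R" "cyc_ring R n" "cyc_class R n" by (rule \<phi>.S.cyc_class_hom)
  note cong = \<phi>.cyc_class_compose_cong[OF assms(1,4,7)]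
    \<phi>.cyc_class_compose_cong[OF assms(2,5,8)] \<phi>.cyc_class_compose_cong[OF assms(3,6,9)]
  show ?thesis
    using assms(1-6) by (simp add: pcomb_def E.comb_def cong)
qed

text \<open>This is \<open>e1 I1 + e2 I2 + e3 I3\<close>, described by representatives in place of a
  map between the quotient rings. By \<open>cyc_class_pcomb_cong\<close> the choice of
  representatives is immaterial.\<close>

definition comb_ideal where
  "comb_ideal n I1 I2 I3 = {cyc_class R n (pcomb f g h) | f g h.
    f \<in> carrier (UP F) \<and> g \<in> carrier (UP F) \<and> h \<in> carrier (UP F) \<and>
    cyc_class F n f \<in> I1 \<and> cyc_class F n g \<in> I2 \<and> cyc_class F n h \<in> I3}"

text \<open>Three multipliers \<open>a\<close>, \<open>b\<close>, \<open>c\<close> over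
  \<open>F\<close> amount to one multiplier \<open>pcomb a b c\<close> over \<open>R\<close>,
  because products are componentwise. Conversely every multiplier over \<open>R\<close> splits in
  this way by \<open>pcomb_surj\<close>.\<close>

lemma comb_ideal_principal:
  assumes "f1 \<in> carrier (UP F)" "f2 \<in> carrier (UP F)" "f3 \<in> carrier (UP F)"
  shows "comb_ideal n (PIdl\<^bsub>cyc_ring F n\<^esub> (cyc_class F n f1)) (PIdl\<^bsub>cyc_ring F n\<^esub> (cyc_class F n f2))
      (PIdl\<^bsub>cyc_ring F n\<^esub> (cyc_class F n f3)) = PIdl\<^bsub>cyc_ring R n\<^esub> (cyc_class R n (pcomb f1 f2 f3))"
    (is "?L = ?R")
proof -
  interpret K: ring_hom_cring "UP R" "cyc_ring R n" "cyc_class R n" by (rule \<phi>.S.cyc_class_hom)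
  interpret L: ring_hom_cring "UP F" "cyc_ring F n" "cyc_class F n" by (rule \<phi>.R.cyc_class_hom)
  \<comment> \<open>The multiplier in the quotient is itself the class of a polynomial, so
    membership in the principal ideal is witnessed before passing to classes.\<close>
  have lift: "\<exists>a\<in>carrier (UP F). cyc_class F n f = cyc_class F n (a \<otimes>\<^bsub>UP F\<^esub> f')"
    if "cyc_class F n f \<in> PIdl\<^bsub>cyc_ring F n\<^esub> (cyc_class F n f')" "f' \<in> carrier (UP F)" for f f'
    using that by (force simp: cgenideal_def \<phi>.R.carrier_cyc_ring)
  show ?thesis
  proof (intro equalityI subsetI)
    fix x assume "x \<in> ?L"
    then obtain f g h where fgh: "f \<in> carrier (UP F)" "g \<in> carrier (UP F)" "h \<in> carrier (UP F)"
      "cyc_class F n f \<in> PIdl\<^bsub>cyc_ring F n\<^esub> (cyc_class F n f1)"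
      "cyc_class F n g \<in> PIdl\<^bsub>cyc_ring F n\<^esub> (cyc_class F n f2)"
      "cyc_class F n h \<in> PIdl\<^bsub>cyc_ring F n\<^esub> (cyc_class F n f3)"
      and x: "x = cyc_class R n (pcomb f g h)"
      by (auto simp: comb_ideal_def)
    obtain a b c where abc: "a \<in> carrier (UP F)" "b \<in> carrier (UP F)" "c \<in> carrier (UP F)"
      "cyc_class F n f = cyc_class F n (a \<otimes>\<^bsub>UP F\<^esub> f1)"
      "cyc_class F n g = cyc_class F n (b \<otimes>\<^bsub>UP F\<^esub> f2)"
      "cyc_class F n h = cyc_class F n (c \<otimes>\<^bsub>UP F\<^esub> f3)"
      using lift fgh(4-6) assms by meson
    have "x = cyc_class R n (pcomb (a \<otimes>\<^bsub>UP F\<^esub> f1) (b \<otimes>\<^bsub>UP F\<^esub> f2) (c \<otimes>\<^bsub>UP F\<^esub> f3))"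
      unfolding x using fgh abc assms by (intro cyc_class_pcomb_cong) auto
    also have "\<dots> = cyc_class R n (pcomb a b c) \<otimes>\<^bsub>cyc_ring R n\<^esub> cyc_class R n (pcomb f1 f2 f3)"
      using abc(1-3) assms by (simp flip: pcomb_mult K.hom_mult)
    finally show "x \<in> ?R"
      using abc(1-3) by (auto simp: cgenideal_def)
  next
    fix x assume "x \<in> ?R"
    then obtain q where q: "q \<in> carrier (UP R)"
      "x = cyc_class R n q \<otimes>\<^bsub>cyc_ring R n\<^esub> cyc_class R n (pcomb f1 f2 f3)"
      by (auto simp: cgenideal_def \<phi>.S.carrier_cyc_ring)
    obtain a b c where abc: "a \<in> carrier (UP F)" "b \<in> carrier (UP F)" "c \<in> carrier (UP F)"
      "q = pcomb a b c"
      using pcomb_surj[OF q(1)] .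
    have "x = cyc_class R n (pcomb (a \<otimes>\<^bsub>UP F\<^esub> f1) (b \<otimes>\<^bsub>UP F\<^esub> f2) (c \<otimes>\<^bsub>UP F\<^esub> f3))"
      using q abc assms by (simp flip: pcomb_mult K.hom_mult)
    moreover have "cyc_class F n (a \<otimes>\<^bsub>UP F\<^esub> f) \<in> PIdl\<^bsub>cyc_ring F n\<^esub> (cyc_class F n f)"
      if "a \<in> carrier (UP F)" "f \<in> carrier (UP F)" for a f
      using that by (auto simp: cgenideal_def)
    ultimately show "x \<in> ?L"
      unfolding comb_ideal_def mem_Collect_eq
      using abc(1-3) assms
      by (intro exI[of _ "a \<otimes>\<^bsub>UP F\<^esub> f1"] exI[of _ "b \<otimes>\<^bsub>UP F\<^esub> f2"] exI[of _ "c \<otimes>\<^bsub>UP F\<^esub> f3"]) simp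
  qed
qed

lemma cyc_class_pcomb_idem:
  assumes "f1 \<in> carrier (UP F)" "f2 \<in> carrier (UP F)" "f3 \<in> carrier (UP F)"
    and "idempotent_elem (cyc_ring F n) (cyc_class F n f1)"
      "idempotent_elem (cyc_ring F n) (cyc_class F n f2)"
      "idempotent_elem (cyc_ring F n) (cyc_class F n f3)"
  shows "idempotent_elem (cyc_ring R n) (cyc_class R n (pcomb f1 f2 f3))"
proof -
  interpret K: ring_hom_cring "UP R" "cyc_ring R n" "cyc_class R n" by (rule \<phi>.S.cyc_class_hom)
  interpret L: ring_hom_cring "UP F" "cyc_ring F n" "cyc_class F n" by (rule \<phi>.R.cyc_class_hom)
  have "cyc_class R n (pcomb f1 f2 f3) \<otimes>\<^bsub>cyc_ring R n\<^esub> cyc_class R n (pcomb f1 f2 f3) =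
      cyc_class R n (pcomb (f1 \<otimes>\<^bsub>UP F\<^esub> f1) (f2 \<otimes>\<^bsub>UP F\<^esub> f2) (f3 \<otimes>\<^bsub>UP F\<^esub> f3))"
    using assms(1-3) by (simp flip: pcomb_mult K.hom_mult)
  also have "\<dots> = cyc_class R n (pcomb f1 f2 f3)"
    using assms by (intro cyc_class_pcomb_cong) (auto simp: idempotent_elem_def)
  finally show ?thesis
    using assms(1-3) by (simp add: idempotent_elem_def)
qed

end

section \<open>Invertibility of \<open>r\<close>, words as polynomials, and the residue ring of
  \<open>v\<close>\<close>

lemma (in field) nat_mult_one_nonzero:
  assumes "card (carrier R) = q" "coprime r q"
  shows "[(r::nat)] \<cdot> \<one> \<noteq> \<zero>"
proof
  assume *: "[r] \<cdot> \<one> = \<zero>"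
  \<comment> \<open>Natural multiples are powers in the additive group, so facts on element orders
    apply. The order of \<open>1\<close> divides the group order \<open>q\<close> and, by
    assumption, \<open>r\<close>; coprimality makes it \<open>1\<close>, whence
    \<open>1 = 0\<close>.\<close>
  have pow: "pow (add_monoid R) \<one> m = [m] \<cdot> \<one>" for m :: nat
    by (simp add: add_pow_def)
  have ord: "[m] \<cdot> \<one> = \<zero> \<longleftrightarrow> group.ord (add_monoid R) \<one> dvd m" for m :: nat
    using group.pow_eq_id[OF add.group_axioms, of \<one> m] unfolding pow by simp
  have "[q] \<cdot> \<one> = \<zero>"
    using group.pow_order_eq_1[OF add.group_axioms, of \<one>] assms(1) unfolding pow order_def by simp
  then have "group.ord (add_monoid R) \<one> dvd q" "group.ord (add_monoid R) \<one> dvd r"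
    using * ord by blast+
  then have "group.ord (add_monoid R) \<one> dvd 1"
    using assms(2) coprime_common_divisor_nat by fastforce
  then have "[(1::nat)] \<cdot> \<one> = \<zero>"
    using ord by blast
  then show False by simp
qed

text \<open>Polynomials are functions on all naturals while words are \<open>undefined\<close> from
  \<open>n\<close> on, so a word becomes a polynomial when padded with zeros. Later arguments then
  work with coefficients instead of sums of monomials.\<close>

lemma (in cring) word_class_eq:
  assumes "c \<in> carrier (vec_module R n)"
  shows "(\<lambda>i. if i < n then c i else \<zero>) \<in> carrier (UP R)"
    and "word_class R n c = cyc_class R n (\<lambda>i. if i < n then c i else \<zero>)"
proof -
  interpret P: UP_cring R "UP R" by unfold_locales
  let ?w = "\<lambda>i. if i < n then c i else \<zero>"
  have c: "c i \<in> carrier R" if "i < n" for i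
    using assms that by (auto simp: vec_module_def)
  then show w: "?w \<in> carrier (UP R)"
    by (auto simp: UP_def intro!: exI[of _ n])
  have "(\<Oplus>\<^bsub>UP R\<^esub>i\<in>{..<n}. monom (UP R) (c i) i) = ?w"
  proof (rule P.up_eqI)
    fix k
    have "coeff (UP R) (\<Oplus>\<^bsub>UP R\<^esub>i\<in>{..<n}. monom (UP R) (c i) i) k =
        (\<Oplus>i\<in>{..<n}. coeff (UP R) (monom (UP R) (c i) i) k)"
      using c by (subst P.coeff_finsum) auto
    also have "\<dots> = (\<Oplus>i\<in>{..<n}. if i = k then c i else \<zero>)"
      using c by (intro finsum_cong') auto
    also have "\<dots> = ?w k"
    proof (cases "k < n")
      case True
      then show ?thesis
        using c by (simp add: add.finprod_singleton_swap)
    next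
      case False
      then have "(\<Oplus>i\<in>{..<n}. if i = k then c i else \<zero>) = (\<Oplus>i\<in>{..<n}. \<zero>)"
        by (intro finsum_cong') auto
      with False show ?thesis by simp
    qed
    finally show "coeff (UP R) (\<Oplus>\<^bsub>UP R\<^esub>i\<in>{..<n}. monom (UP R) (c i) i) k = coeff (UP R) ?w k"
      using w by (simp add: UP_def)
  qed (use c w in \<open>auto intro!: P.P.finsum_closed\<close>)
  then show "word_class R n c = cyc_class R n ?w"
    by (simp add: word_class_def)
qed

text \<open>All four facts come from the canonical projection: \<open>v_const\<close> is its
  composite with the embedding of constants, and \<open>v^(r+1) = v\<close> holds because the
  difference of the two monomials generates the modulus.\<close>

lemma (in cring) v_const_hom: "v_const R r \<in> ring_hom R (v_ring R r)"
  and v_ring_cring: "cring (v_ring R r)"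
  and v_elem_closed: "v_elem R r \<in> carrier (v_ring R r)"
  and v_elem_pow: "v_elem R r [^]\<^bsub>v_ring R r\<^esub> Suc r = v_elem R r"
proof -
  interpret P: UP_cring R "UP R" by unfold_locales
  interpret I: ideal "v_modulus R r" "UP R"
    unfolding v_modulus_def by (intro P.cgenideal_ideal) simp
  interpret K: ring_hom_cring "UP R" "v_ring R r" "(+>\<^bsub>UP R\<^esub>) (v_modulus R r)"
    unfolding v_ring_def by (rule I.rcos_ring_hom_cring[OF P.P.is_cring])
  show "cring (v_ring R r)" by (rule K.S.is_cring)
  have "v_const R r = (+>\<^bsub>UP R\<^esub>) (v_modulus R r) \<circ> (\<lambda>a. monom (UP R) a 0)"
    by (auto simp: v_const_def)
  then show "v_const R r \<in> ring_hom R (v_ring R r)"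
    using ring_hom_trans[OF P.const_ring_hom K.homh] by simp
  show "v_elem R r \<in> carrier (v_ring R r)"
    by (simp add: v_elem_def)
  have "monom (UP R) \<one> (r + 1) \<ominus>\<^bsub>UP R\<^esub> monom (UP R) \<one> 1 \<in> v_modulus R r"
    unfolding v_modulus_def by (intro P.cgenideal_self) simp
  then have "v_modulus R r +>\<^bsub>UP R\<^esub> monom (UP R) \<one> (r + 1) = v_elem R r"
    using P.P.quotient_eq_iff_same_a_r_cos[OF I.is_ideal] by (simp add: v_elem_def)
  moreover have "v_elem R r [^]\<^bsub>v_ring R r\<^esub> Suc r =
      v_modulus R r +>\<^bsub>UP R\<^esub> (monom (UP R) \<one> 1 [^]\<^bsub>UP R\<^esub> Suc r)"
    unfolding v_elem_def by (rule K.hom_pow [symmetric]) simp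
  moreover have "monom (UP R) \<one> 1 [^]\<^bsub>UP R\<^esub> Suc r = monom (UP R) \<one> (r + 1)"
    by (subst P.monom_pow) simp_all
  ultimately show "v_elem R r [^]\<^bsub>v_ring R r\<^esub> Suc r = v_elem R r"
    by metis
qed

section \<open>The idempotents in the residue ring and the subring they span\<close>

locale e_ring_setting = field F for F (structure) +
  fixes r :: nat
  assumes r_pos: "r > 0" and r_inv: "[r] \<cdot> \<one> \<noteq> \<zero>"
begin

sublocale V: ring_hom_cring F "v_ring F r" "v_const F r"
  by (intro ring_hom_cring.intro ring_hom_cring_axioms.intro v_const_hom v_ring_cring is_cring)


lemma v_const_nat_mult_one: "v_const F r ([(m::nat)] \<cdot> \<one>) = [m] \<cdot>\<^bsub>v_ring F r\<^esub> \<one>\<^bsub>v_ring F r\<^esub>"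
  by (induction m) simp_all

text \<open>Since \<open>(r - 1)/r = 1 - 1/r\<close>, the coefficient of \<open>v^r\<close> splits
  off a term \<open>-v^r/r\<close>, which completes the sum up to \<open>r - 1\<close> to the sum in
  \<open>idem_e1\<close>.\<close>

lemma idem_e2_eq:
  "idem_e2 F r = v_elem F r [^]\<^bsub>v_ring F r\<^esub> r \<ominus>\<^bsub>v_ring F r\<^esub> idem_e1 F r"
proof -
  define d where "d = [r] \<cdot> \<one>"
  define c where "c = v_const F r (inv d)"
  define w where "w = v_elem F r [^]\<^bsub>v_ring F r\<^esub> r"
  define t where "t = (\<Oplus>\<^bsub>v_ring F r\<^esub>i\<in>{1..r - 1}. v_elem F r [^]\<^bsub>v_ring F r\<^esub> i)"
  have d: "d \<in> carrier F" "inv d \<in> carrier F" "d \<otimes> inv d = \<one>"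
    using r_inv by (simp_all add: d_def field_Units)
  have [simp]: "c \<in> carrier (v_ring F r)" "w \<in> carrier (v_ring F r)" "t \<in> carrier (v_ring F r)"
    using d v_elem_closed[of r] by (auto simp: c_def w_def t_def)
  obtain m where m: "r = Suc m" using r_pos by (cases r) auto
  have ins: "{1..r} = insert r {1..r - 1}" and notin: "r \<notin> {1..r - 1}"
    using m by auto
  have "(\<Oplus>\<^bsub>v_ring F r\<^esub>i\<in>{1..r}. v_elem F r [^]\<^bsub>v_ring F r\<^esub> i) = w \<oplus>\<^bsub>v_ring F r\<^esub> t"
    unfolding ins w_def t_def using notin v_elem_closed[of r] by (subst V.S.finsum_insert) auto
  then have e1: "idem_e1 F r = c \<otimes>\<^bsub>v_ring F r\<^esub> (w \<oplus>\<^bsub>v_ring F r\<^esub> t)"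
    by (simp add: idem_e1_def c_def d_def)
  have "d = [(r - 1)] \<cdot> \<one> \<oplus> \<one>"
    by (simp add: d_def m)
  then have "[(r - 1)] \<cdot> \<one> = d \<ominus> \<one>"
    by (simp add: minus_eq a_assoc r_neg)
  then have "([(r - 1)] \<cdot> \<one>) \<otimes> inv d = \<one> \<ominus> inv d"
    using d by (simp add: minus_eq l_distr l_minus)
  then have k: "v_const F r (([(r - 1)] \<cdot> \<one>) \<otimes> inv d) = \<one>\<^bsub>v_ring F r\<^esub> \<ominus>\<^bsub>v_ring F r\<^esub> c"
    using d by (simp add: c_def minus_eq V.S.minus_eq)
  have "idem_e2 F r = \<ominus>\<^bsub>v_ring F r\<^esub> (c \<otimes>\<^bsub>v_ring F r\<^esub> t) \<oplus>\<^bsub>v_ring F r\<^esub>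
      (\<one>\<^bsub>v_ring F r\<^esub> \<ominus>\<^bsub>v_ring F r\<^esub> c) \<otimes>\<^bsub>v_ring F r\<^esub> w"
    unfolding k[symmetric] by (simp add: idem_e2_def c_def w_def t_def d_def)
  also have "\<dots> = w \<ominus>\<^bsub>v_ring F r\<^esub> c \<otimes>\<^bsub>v_ring F r\<^esub> (w \<oplus>\<^bsub>v_ring F r\<^esub> t)"
    by (simp add: V.S.minus_eq V.S.l_distr V.S.r_distr V.S.l_minus V.S.minus_add V.S.a_ac)
  finally show ?thesis by (simp add: e1 w_def)
qed

sublocale V: orth_idempotents "v_ring F r" "idem_e1 F r" "idem_e2 F r" "idem_e3 F r"
proof -
  have "v_const F r (inv ([r] \<cdot> \<one>)) \<otimes>\<^bsub>v_ring F r\<^esub> ([r] \<cdot>\<^bsub>v_ring F r\<^esub> \<one>\<^bsub>v_ring F r\<^esub>)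
      = \<one>\<^bsub>v_ring F r\<^esub>"
    using r_inv by (simp add: field_Units flip: v_const_nat_mult_one V.hom_mult)
  then show "orth_idempotents (v_ring F r) (idem_e1 F r) (idem_e2 F r) (idem_e3 F r)"
    using r_inv unfolding idem_e2_eq unfolding idem_e1_def idem_e3_def
    by (intro V.S.orth_idempotents_of_pow_Suc_eq v_elem_closed v_elem_pow r_pos refl)
      (simp_all add: field_Units)
qed

lemma e_comb_eq: "e_comb F r a b c = V.comb (v_const F r a) (v_const F r b) (v_const F r c)"
  by (simp add: e_comb_def V.comb_def)

lemma e_ring_simps:
  "mult (e_ring F r) = mult (v_ring F r)" "one (e_ring F r) = one (v_ring F r)"
  "zero (e_ring F r) = zero (v_ring F r)" "add (e_ring F r) = add (v_ring F r)"
  by (simp_all add: e_ring_def)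

lemma carrier_e_ring:
  "carrier (e_ring F r) =
    {e_comb F r a b c | a b c. a \<in> carrier F \<and> b \<in> carrier F \<and> c \<in> carrier F}"
  by (simp add: e_ring_def)

lemma subring_e_ring: "subring (carrier (e_ring F r)) (v_ring F r)"
proof (rule V.S.subringI)
  show "carrier (e_ring F r) \<subseteq> carrier (v_ring F r)"
    by (auto simp: carrier_e_ring e_comb_eq)
  have "e_comb F r \<one> \<one> \<one> = \<one>\<^bsub>v_ring F r\<^esub>"
    by (simp add: e_comb_eq V.comb_diag)
  then show "\<one>\<^bsub>v_ring F r\<^esub> \<in> carrier (e_ring F r)"
    unfolding carrier_e_ring by force
next
  fix x y assume "x \<in> carrier (e_ring F r)" "y \<in> carrier (e_ring F r)"
  then obtain a b c a' b' c' where
    abc: "a \<in> carrier F" "b \<in> carrier F" "c \<in> carrier F" "x = e_comb F r a b c"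
      "a' \<in> carrier F" "b' \<in> carrier F" "c' \<in> carrier F" "y = e_comb F r a' b' c'"
    by (auto simp: carrier_e_ring)
  have "x \<oplus>\<^bsub>v_ring F r\<^esub> y = e_comb F r (a \<oplus> a') (b \<oplus> b') (c \<oplus> c')"
    using abc by (simp add: e_comb_eq V.comb_add)
  then show "x \<oplus>\<^bsub>v_ring F r\<^esub> y \<in> carrier (e_ring F r)"
    using abc unfolding carrier_e_ring by blast
  have "x \<otimes>\<^bsub>v_ring F r\<^esub> y = e_comb F r (a \<otimes> a') (b \<otimes> b') (c \<otimes> c')"
    using abc by (simp add: e_comb_eq V.comb_mult)
  then show "x \<otimes>\<^bsub>v_ring F r\<^esub> y \<in> carrier (e_ring F r)"
    using abc unfolding carrier_e_ring by blast
next
  fix x assume "x \<in> carrier (e_ring F r)"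
  then obtain a b c where
    abc: "a \<in> carrier F" "b \<in> carrier F" "c \<in> carrier F" "x = e_comb F r a b c"
    by (auto simp: carrier_e_ring)
  have "\<ominus>\<^bsub>v_ring F r\<^esub> x = e_comb F r (\<ominus> a) (\<ominus> b) (\<ominus> c)"
    using abc by (simp add: e_comb_eq V.comb_def V.S.r_minus V.S.minus_add)
  then show "\<ominus>\<^bsub>v_ring F r\<^esub> x \<in> carrier (e_ring F r)"
    using abc unfolding carrier_e_ring by blast
qed

lemma e_ring_cring: "cring (e_ring F r)"
proof -
  have "cring ((v_ring F r)\<lparr>carrier := carrier (e_ring F r)\<rparr>)"
    using V.S.subcring_iff[OF subringE(1)[OF subring_e_ring]] V.S.subcringI'[OF subring_e_ring] by simp
  then show ?thesis by (simp add: e_ring_def)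
qed

lemma idem_in_e_ring:
  "idem_e1 F r \<in> carrier (e_ring F r)" "idem_e2 F r \<in> carrier (e_ring F r)"
  "idem_e3 F r \<in> carrier (e_ring F r)"
proof -
  have "idem_e1 F r = e_comb F r \<one> \<zero> \<zero>" "idem_e2 F r = e_comb F r \<zero> \<one> \<zero>"
    "idem_e3 F r = e_comb F r \<zero> \<zero> \<one>"
    by (simp_all add: e_comb_eq V.comb_def)
  then show "idem_e1 F r \<in> carrier (e_ring F r)" "idem_e2 F r \<in> carrier (e_ring F r)"
    "idem_e3 F r \<in> carrier (e_ring F r)"
    unfolding carrier_e_ring by blast+
qed

lemma orth_idempotents_e_ring:
  "orth_idempotents (e_ring F r) (idem_e1 F r) (idem_e2 F r) (idem_e3 F r)"
  by (intro orth_idempotents.intro orth_idempotents_axioms.intro e_ring_cring)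
    (simp_all add: e_ring_simps idem_in_e_ring V.idem V.orth V.total)

text \<open>By \<open>comb_diag\<close> a scalar \<open>a\<close> equals
  \<open>e_comb F r a a a\<close>, so the structure map already lands in the subring.\<close>

lemma v_const_hom_e_ring: "v_const F r \<in> ring_hom F (e_ring F r)"
proof (rule ring_hom_memI)
  fix a assume a: "a \<in> carrier F"
  then have "v_const F r a = e_comb F r a a a"
    by (simp add: e_comb_eq V.comb_diag)
  then show "v_const F r a \<in> carrier (e_ring F r)"
    using a unfolding carrier_e_ring by blast
qed (simp_all add: e_ring_simps)

sublocale X: idempotent_extension F "e_ring F r" "v_const F r" "idem_e1 F r" "idem_e2 F r" "idem_e3 F r"
proof -
  have comb: "orth_idempotents.comb (e_ring F r) (idem_e1 F r) (idem_e2 F r) (idem_e3 F r)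
      (v_const F r a) (v_const F r b) (v_const F r c) = e_comb F r a b c" for a b c
    by (simp add: orth_idempotents.comb_def[OF orth_idempotents_e_ring] e_comb_def e_ring_simps)
  show "idempotent_extension F (e_ring F r) (v_const F r) (idem_e1 F r) (idem_e2 F r) (idem_e3 F r)"
  proof (intro idempotent_extension.intro idempotent_extension_axioms.intro ring_hom_cring.intro
      ring_hom_cring_axioms.intro is_cring e_ring_cring orth_idempotents_e_ring v_const_hom_e_ring)
    fix x assume "x \<in> carrier (e_ring F r)"
    then show "\<exists>a\<in>carrier F. \<exists>b\<in>carrier F. \<exists>c\<in>carrier F.
      x = orth_idempotents.comb (e_ring F r) (idem_e1 F r) (idem_e2 F r) (idem_e3 F r)
        (v_const F r a) (v_const F r b) (v_const F r c)"
      unfolding comb carrier_e_ring by blast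
  qed
qed

end

section \<open>Decomposition of codes into their components\<close>

lemma (in orth_idempotents) comb_glue:
  assumes "x \<in> carrier R" "y \<in> carrier R" "z \<in> carrier R" "x' \<in> carrier R" "y' \<in> carrier R"
    "z' \<in> carrier R" "x'' \<in> carrier R" "y'' \<in> carrier R" "z'' \<in> carrier R"
  shows "e1 \<otimes> comb x y' z'' \<oplus> e2 \<otimes> comb x'' y z' \<oplus> e3 \<otimes> comb x' y'' z = comb x y z"
proof -
  \<comment> \<open>Multiplication by one idempotent retains only the matching coordinate, so the
    six primed entries vanish.\<close>
  have orth': "e2 \<otimes> e1 = \<zero>" "e3 \<otimes> e1 = \<zero>" "e3 \<otimes> e2 = \<zero>"
    using orth by (simp_all add: m_comm)
  show ?thesis
    using assms by (simp add: comb_def r_distr idem orth orth' flip: m_assoc)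
qed

lemma linear_codeD:
  assumes "linear_code A n C"
  shows "C \<subseteq> carrier (vec_module A n)"
    and "\<And>c d. \<lbrakk>c \<in> C; d \<in> C\<rbrakk> \<Longrightarrow> (\<lambda>i\<in>{..<n}. c i \<oplus>\<^bsub>A\<^esub> d i) \<in> C"
    and "\<And>a c. \<lbrakk>a \<in> carrier A; c \<in> C\<rbrakk> \<Longrightarrow> (\<lambda>i\<in>{..<n}. a \<otimes>\<^bsub>A\<^esub> c i) \<in> C"
proof -
  interpret submodule C A "vec_module A n"
    using assms by (simp add: linear_code_def)
  show "C \<subseteq> carrier (vec_module A n)"
    using subset by simp
  show "(\<lambda>i\<in>{..<n}. c i \<oplus>\<^bsub>A\<^esub> d i) \<in> C" if "c \<in> C" "d \<in> C" for c d
    using m_closed[OF that] by (simp add: vec_module_def)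
  show "(\<lambda>i\<in>{..<n}. a \<otimes>\<^bsub>A\<^esub> c i) \<in> C" if "a \<in> carrier A" "c \<in> C" for a c
    using smult_closed[OF that] by (simp add: vec_module_def)
qed

context e_ring_setting
begin

lemma poly_comb_eq:
  "\<lbrakk>f \<in> carrier (UP F); g \<in> carrier (UP F); h \<in> carrier (UP F)\<rbrakk>
    \<Longrightarrow> poly_comb F r f g h = X.pcomb f g h"
  by (simp add: poly_comb_def X.pcomb_smult)

lemma word_comb_closed:
  assumes "s \<in> carrier (vec_module F n)" "t \<in> carrier (vec_module F n)" "u \<in> carrier (vec_module F n)"
  shows "word_comb F r n s t u \<in> carrier (vec_module (e_ring F r) n)"
proof -
  have "e_comb F r (s i) (t i) (u i) \<in> carrier (e_ring F r)" if "i < n" for i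
    using assms that unfolding carrier_e_ring by (simp add: vec_module_def PiE_iff) blast
  then show ?thesis
    by (simp add: word_comb_def vec_module_def)
qed

lemma word_comb_surj:
  assumes "c \<in> carrier (vec_module (e_ring F r) n)"
  obtains s t u where "s \<in> carrier (vec_module F n)" "t \<in> carrier (vec_module F n)"
    "u \<in> carrier (vec_module F n)" "c = word_comb F r n s t u"
proof -
  have "\<exists>x y z. x \<in> carrier F \<and> y \<in> carrier F \<and> z \<in> carrier F \<and> c i = e_comb F r x y z"
    if "i \<in> {..<n}" for i
  proof -
    have "c i \<in> carrier (e_ring F r)"
      using assms that by (auto simp: vec_module_def)
    then show ?thesis
      unfolding carrier_e_ring by blast
  qed
  then obtain s t u where stu:
    "\<forall>i\<in>{..<n}. s i \<in> carrier F \<and> t i \<in> carrier F \<and> u i \<in> carrier F \<and> c i = e_comb F r (s i) (t i) (u i)"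
    by metis
  show ?thesis
  \<comment> \<open>The chosen coordinates are restricted to \<open>{..<n}\<close> because words are
    extensional.\<close>
  proof (rule that)
    show "restrict s {..<n} \<in> carrier (vec_module F n)" "restrict t {..<n} \<in> carrier (vec_module F n)"
      "restrict u {..<n} \<in> carrier (vec_module F n)"
      using stu by (auto simp: vec_module_def)
    have "c = restrict c {..<n}"
      using assms by (auto simp: vec_module_def)
    also have "\<dots> = word_comb F r n (restrict s {..<n}) (restrict t {..<n}) (restrict u {..<n})"
      unfolding word_comb_def using stu by (intro restrict_ext) auto
    finally show "c = word_comb F r n (restrict s {..<n}) (restrict t {..<n}) (restrict u {..<n})" .
  qed
qed

text \<open>The padded combined word and the combination of padded words agree coefficientwise; from
  \<open>n\<close> on this says that the combination of three zeros is zero.\<close>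

lemma word_class_word_comb:
  assumes "s \<in> carrier (vec_module F n)" "t \<in> carrier (vec_module F n)" "u \<in> carrier (vec_module F n)"
  shows "word_class (e_ring F r) n (word_comb F r n s t u) = cyc_class (e_ring F r) n
    (X.pcomb (\<lambda>i. if i < n then s i else \<zero>) (\<lambda>i. if i < n then t i else \<zero>)
      (\<lambda>i. if i < n then u i else \<zero>))"
proof -
  have "(\<lambda>i. if i < n then word_comb F r n s t u i else \<zero>\<^bsub>e_ring F r\<^esub>) =
    X.pcomb (\<lambda>i. if i < n then s i else \<zero>) (\<lambda>i. if i < n then t i else \<zero>)
      (\<lambda>i. if i < n then u i else \<zero>)"
    using word_class_eq(1)[OF assms(1)] word_class_eq(1)[OF assms(2)] word_class_eq(1)[OF assms(3)]
    by (intro ext) (simp add: X.pcomb_nth X.comb_diag X.comb_def word_comb_def e_comb_def e_ring_simps)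
  then show ?thesis
    using cring.word_class_eq(2)[OF e_ring_cring word_comb_closed[OF assms]] by simp
qed

text \<open>Membership in the components is witnessed by three possibly different codewords.
  Linearity over \<open>R\<close> allows them to be multiplied by \<open>e1\<close>,
  \<open>e2\<close>, \<open>e3\<close> and added, which leaves exactly the prescribed
  coordinates.\<close>

lemma word_comb_mem:
  assumes C: "linear_code (e_ring F r) n C"
    and "s \<in> component1 F r n C" "t \<in> component2 F r n C" "u \<in> component3 F r n C"
  shows "word_comb F r n s t u \<in> C"
proof -
  have V: "s \<in> carrier (vec_module F n)" "t \<in> carrier (vec_module F n)" "u \<in> carrier (vec_module F n)"
    using assms(2-4) by (simp_all add: component1_def component2_def component3_def)
  obtain t1 u1 where V1: "t1 \<in> carrier (vec_module F n)" "u1 \<in> carrier (vec_module F n)"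
    and W1: "word_comb F r n s t1 u1 \<in> C"
    using assms(2) by (auto simp: component1_def)
  obtain s2 u2 where V2: "s2 \<in> carrier (vec_module F n)" "u2 \<in> carrier (vec_module F n)"
    and W2: "word_comb F r n s2 t u2 \<in> C"
    using assms(3) by (auto simp: component2_def)
  obtain s3 t3 where V3: "s3 \<in> carrier (vec_module F n)" "t3 \<in> carrier (vec_module F n)"
    and W3: "word_comb F r n s3 t3 u \<in> C"
    using assms(4) by (auto simp: component3_def)
  have mem: "v_const F r (w i) \<in> carrier (v_ring F r)"
    if "w \<in> carrier (vec_module F n)" "i < n" for w i
    using that by (auto simp: vec_module_def)
  note mems = V[THEN mem] V1[THEN mem] V2[THEN mem] V3[THEN mem]
  note D = linear_codeD[OF C]
  \<comment> \<open>The nested restrictions reproduce the shape of the closure rules of a linear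
    code; they collapse in the next step.\<close>
  have "(\<lambda>i\<in>{..<n}. (\<lambda>i\<in>{..<n}. (\<lambda>i\<in>{..<n}. idem_e1 F r \<otimes>\<^bsub>e_ring F r\<^esub> word_comb F r n s t1 u1 i) i
      \<oplus>\<^bsub>e_ring F r\<^esub> (\<lambda>i\<in>{..<n}. idem_e2 F r \<otimes>\<^bsub>e_ring F r\<^esub> word_comb F r n s2 t u2 i) i) i
      \<oplus>\<^bsub>e_ring F r\<^esub> (\<lambda>i\<in>{..<n}. idem_e3 F r \<otimes>\<^bsub>e_ring F r\<^esub> word_comb F r n s3 t3 u i) i) \<in> C"
    (is "?w \<in> C")
    by (intro D(2,3) W1 W2 W3 idem_in_e_ring)
  also have "?w = word_comb F r n s t u"
    unfolding word_comb_def
  proof (rule restrict_ext)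
    fix i assume "i \<in> {..<n}"
    then show "(\<lambda>i\<in>{..<n}. (\<lambda>i\<in>{..<n}. idem_e1 F r \<otimes>\<^bsub>e_ring F r\<^esub> (\<lambda>i\<in>{..<n}. e_comb F r (s i) (t1 i) (u1 i)) i) i
      \<oplus>\<^bsub>e_ring F r\<^esub> (\<lambda>i\<in>{..<n}. idem_e2 F r \<otimes>\<^bsub>e_ring F r\<^esub> (\<lambda>i\<in>{..<n}. e_comb F r (s2 i) (t i) (u2 i)) i) i) i
      \<oplus>\<^bsub>e_ring F r\<^esub> (\<lambda>i\<in>{..<n}. idem_e3 F r \<otimes>\<^bsub>e_ring F r\<^esub> (\<lambda>i\<in>{..<n}. e_comb F r (s3 i) (t3 i) (u i)) i) i
      = e_comb F r (s i) (t i) (u i)"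
      using V.comb_glue mems by (simp add: e_ring_simps e_comb_eq)
  qed
  finally show ?thesis .
qed

text \<open>This is \<open>C = e1 C1 + e2 C2 + e3 C3\<close> carried over to residue classes. One
  inclusion splits a codeword into coordinates, the other glues coordinates by
  \<open>word_comb_mem\<close>.\<close>

lemma code_ideal_eq_comb_ideal:
  assumes C: "linear_code (e_ring F r) n C"
  shows "code_ideal (e_ring F r) n C = X.comb_ideal n (code_ideal F n (component1 F r n C))
    (code_ideal F n (component2 F r n C)) (code_ideal F n (component3 F r n C))"
proof (intro equalityI subsetI)
  fix x assume "x \<in> code_ideal (e_ring F r) n C"
  then obtain c where c: "c \<in> C" "x = word_class (e_ring F r) n c"
    by (auto simp: code_ideal_def)
  then have "c \<in> carrier (vec_module (e_ring F r) n)"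
    using linear_codeD(1)[OF C] by auto
  from word_comb_surj[OF this] obtain s t u where V: "s \<in> carrier (vec_module F n)"
    "t \<in> carrier (vec_module F n)" "u \<in> carrier (vec_module F n)" and "c = word_comb F r n s t u" .
  with c have x: "x = word_class (e_ring F r) n (word_comb F r n s t u)"
    and W: "word_comb F r n s t u \<in> C"
    by simp_all
  have "s \<in> component1 F r n C" "t \<in> component2 F r n C" "u \<in> component3 F r n C"
    using V W unfolding component1_def component2_def component3_def by blast+
  then have "cyc_class F n (\<lambda>i. if i < n then s i else \<zero>) \<in> code_ideal F n (component1 F r n C)"
    "cyc_class F n (\<lambda>i. if i < n then t i else \<zero>) \<in> code_ideal F n (component2 F r n C)"
    "cyc_class F n (\<lambda>i. if i < n then u i else \<zero>) \<in> code_ideal F n (component3 F r n C)"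
    unfolding code_ideal_def V[THEN word_class_eq(2), symmetric] by blast+
  then show "x \<in> X.comb_ideal n (code_ideal F n (component1 F r n C))
      (code_ideal F n (component2 F r n C)) (code_ideal F n (component3 F r n C))"
    unfolding X.comb_ideal_def x word_class_word_comb[OF V]
    using V[THEN word_class_eq(1)] by blast
next
  fix x assume "x \<in> X.comb_ideal n (code_ideal F n (component1 F r n C))
      (code_ideal F n (component2 F r n C)) (code_ideal F n (component3 F r n C))"
  then obtain f g h s t u where
    fgh: "f \<in> carrier (UP F)" "g \<in> carrier (UP F)" "h \<in> carrier (UP F)"
    and x: "x = cyc_class (e_ring F r) n (X.pcomb f g h)"
    and stu: "s \<in> component1 F r n C" "t \<in> component2 F r n C" "u \<in> component3 F r n C"
    and cls: "cyc_class F n f = word_class F n s" "cyc_class F n g = word_class F n t"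
      "cyc_class F n h = word_class F n u"
    unfolding X.comb_ideal_def code_ideal_def by blast
  have V: "s \<in> carrier (vec_module F n)" "t \<in> carrier (vec_module F n)" "u \<in> carrier (vec_module F n)"
    using stu by (simp_all add: component1_def component2_def component3_def)
  \<comment> \<open>The polynomials \<open>f\<close>, \<open>g\<close>, \<open>h\<close> may have
    any degree and only share their classes with the words, so they are first replaced by the padded
    words.\<close>
  have "x = word_class (e_ring F r) n (word_comb F r n s t u)"
    unfolding x word_class_word_comb[OF V]
    using fgh V[THEN word_class_eq(1)] cls[unfolded V[THEN word_class_eq(2)]]
    by (rule X.cyc_class_pcomb_cong)
  then show "x \<in> code_ideal (e_ring F r) n C"
    unfolding code_ideal_def using word_comb_mem[OF C stu] by blast
qed

end

section \<open>Existence and uniqueness of the generating idempotent\<close>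

theorem corollary4:
  fixes F :: "('a, 'm) ring_scheme"
    and p k r n :: nat
    and C :: "(nat \<Rightarrow> (nat \<Rightarrow> 'a) set) set"
    and f1 f2 f3 :: "nat \<Rightarrow> 'a"
  assumes "prime p" and "k \<ge> 1"
    and "field F" and "card (carrier F) = p ^ k"
    and "r > 1" and "gcd r p = 1" and "gcd n p = 1"
    and "cyclic_code (e_ring F r) n C"
    and "f1 \<in> carrier (UP F)" and "f2 \<in> carrier (UP F)" and "f3 \<in> carrier (UP F)"
    and "idempotent_elem (cyc_ring F n) (cyc_class F n f1)"
    and "idempotent_elem (cyc_ring F n) (cyc_class F n f2)"
    and "idempotent_elem (cyc_ring F n) (cyc_class F n f3)"
    and "code_ideal F n (component1 F r n C) = PIdl\<^bsub>cyc_ring F n\<^esub> (cyc_class F n f1)"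
    and "code_ideal F n (component2 F r n C) = PIdl\<^bsub>cyc_ring F n\<^esub> (cyc_class F n f2)"
    and "code_ideal F n (component3 F r n C) = PIdl\<^bsub>cyc_ring F n\<^esub> (cyc_class F n f3)"
  shows "let S = cyc_ring (e_ring F r) n;
             I = code_ideal (e_ring F r) n C;
             P = (\<lambda>e. e \<in> I \<and> idempotent_elem S e \<and> I = PIdl\<^bsub>S\<^esub> e)
         in (\<exists>!e. P e) \<and> P (cyc_class (e_ring F r) n (poly_comb F r f1 f2 f3))"
proof -
  interpret field F by fact
  \<comment> \<open>Coprimality with the cardinality of \<open>F\<close> is what makes
    \<open>r\<close> nonzero in \<open>F\<close>.\<close>
  have "coprime r (p ^ k)"
    using \<open>gcd r p = 1\<close> coprime_iff_gcd_eq_1 coprime_power_right_iff by blast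
  then interpret e_ring_setting F r
    using nat_mult_one_nonzero[OF \<open>card (carrier F) = p ^ k\<close>] \<open>r > 1\<close> by unfold_locales auto
  interpret K: ring_hom_cring "UP (e_ring F r)" "cyc_ring (e_ring F r) n" "cyc_class (e_ring F r) n"
    by (rule cring.cyc_class_hom[OF e_ring_cring])
  define I where "I = code_ideal (e_ring F r) n C"
  define e where "e = cyc_class (e_ring F r) n (poly_comb F r f1 f2 f3)"
  have "linear_code (e_ring F r) n C"
    using \<open>cyclic_code (e_ring F r) n C\<close> by (simp add: cyclic_code_def)
  then have I: "I = PIdl\<^bsub>cyc_ring (e_ring F r) n\<^esub> e"
    using assms(9-11,15-17)
    by (simp add: I_def e_def code_ideal_eq_comb_ideal X.comb_ideal_principal poly_comb_eq)
  have e: "idempotent_elem (cyc_ring (e_ring F r) n) e"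
    using assms(9-14) by (simp add: e_def poly_comb_eq X.cyc_class_pcomb_idem)
  then have "e \<in> I"
    unfolding I by (intro K.S.cgenideal_self) (simp add: idempotent_elem_def)
  \<comment> \<open>Any competitor is an idempotent generating the same ideal of the commutative
    quotient ring.\<close>
  moreover have "e' = e"
    if "idempotent_elem (cyc_ring (e_ring F r) n) e'" "I = PIdl\<^bsub>cyc_ring (e_ring F r) n\<^esub> e'" for e'
    using that e I K.S.cgenideal_idem_unique[of e' e] by (simp add: idempotent_elem_def)
  ultimately show ?thesis
    unfolding Let_def I_def[symmetric] e_def[symmetric] using I e by blast
qed

end
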